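(* Let $X$ be a non-empty set and let $\eta: X\times X \to [0,\infty]$ be a function satisfying $\eta(u,x)\leq \eta(u,z)+\eta(z,x)$ for all $u,x,z\in X$. Consider an $\varepsilon > 0$, a point $x \in X$, and a function $\varphi: X \to [0,\infty]$ such that $\eta(x,x) < \infty$ and $\varepsilon < \varphi(x) < \infty$. Then there exists a point $u \in X$ such that $\varphi(u) + \eta(u,x) \leq \varphi(x) + \eta(x,x)$ and $$\varphi(u') + \eta(u',u) > \varphi(u) - \varepsilon \quad \mbox{for every } u'\in X.$$
   Context: No topology, completeness or lower semi-continuity is assumed; $\eta$ need not be symmetric nor vanish on the diagonal. *)

theory Defs
  imports "HOL-Library.Extended_Nonnegative_Real"
begin

end

theory Submission imports Defs begin

text \<open>Follow the potential \<open>\<phi> u + \<eta> u x\<close>, which starts at the finite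
  value \<open>\<phi> x + \<eta> x x\<close>. If no point worked, every \<open>u\<close> whose
  potential is at most this value would violate the second inequality for some \<open>u'\<close>;
  the triangle inequality through \<open>u\<close> then makes the potential of \<open>u'\<close>
  smaller by at least \<open>\<epsilon>\<close>. Iterating from \<open>x\<close> drives a
  nonnegative quantity down by \<open>\<epsilon>\<close> indefinitely, which is impossible. The
  lemma below turns the violated inequality, whose \<open>ereal\<close> difference may be negative,
  into an additive one in \<open>ennreal\<close>, free of truncated subtraction.\<close>

lemma enn2ereal_le_minus_ereal:
  assumes "0 \<le> \<epsilon>" and "enn2ereal a \<le> enn2ereal b - ereal \<epsilon>"
  shows "a + ennreal \<epsilon> \<le> b"
proof -
  have "enn2ereal a + ereal \<epsilon> \<le> enn2ereal b"
    using assms(2) by (simp add: ereal_le_minus)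
  then show ?thesis
    using assms(1) by (simp add: less_eq_ennreal.rep_eq plus_ennreal.rep_eq enn2ereal_ennreal)
qed

theorem corollary2p6:
  fixes X :: "'a set"
    and \<eta> :: "'a \<Rightarrow> 'a \<Rightarrow> ennreal"
    and \<phi> :: "'a \<Rightarrow> ennreal"
    and \<epsilon> :: real
    and x :: 'a
  assumes "X \<noteq> {}"
    and "\<And>u y z. u \<in> X \<Longrightarrow> y \<in> X \<Longrightarrow> z \<in> X \<Longrightarrow> \<eta> u y \<le> \<eta> u z + \<eta> z y"
    and "\<epsilon> > 0"
    and "x \<in> X"
    and "\<eta> x x < \<infinity>"
    and "ennreal \<epsilon> < \<phi> x"
    and "\<phi> x < \<infinity>"
  shows "\<exists>u\<in>X. \<phi> u + \<eta> u x \<le> \<phi> x + \<eta> x x \<and>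
    (\<forall>u'\<in>X. enn2ereal (\<phi> u' + \<eta> u' u) > enn2ereal (\<phi> u) - ereal \<epsilon>)"
proof (rule ccontr)
  assume no_point: "\<not> ?thesis"
  have descent: "\<exists>u'\<in>X. \<phi> u' + \<eta> u' x + ennreal \<epsilon> \<le> \<phi> u + \<eta> u x"
    if u: "u \<in> X" "\<phi> u + \<eta> u x \<le> \<phi> x + \<eta> x x" for u
  proof -
    obtain u' where u': "u' \<in> X" "enn2ereal (\<phi> u' + \<eta> u' u) \<le> enn2ereal (\<phi> u) - ereal \<epsilon>"
      using no_point u by (auto simp: not_less)
    have step: "\<phi> u' + \<eta> u' u + ennreal \<epsilon> \<le> \<phi> u"
      using u'(2) \<open>\<epsilon> > 0\<close> by (intro enn2ereal_le_minus_ereal) auto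
    have "\<phi> u' + \<eta> u' x + ennreal \<epsilon> \<le> \<phi> u' + (\<eta> u' u + \<eta> u x) + ennreal \<epsilon>"
      using assms(2)[OF u'(1) \<open>x \<in> X\<close> u(1)] by (intro add_mono) auto
    also have "\<dots> = (\<phi> u' + \<eta> u' u + ennreal \<epsilon>) + \<eta> u x"
      by (simp add: ac_simps)
    also have "\<dots> \<le> \<phi> u + \<eta> u x"
      using step by (intro add_mono) auto
    finally show ?thesis
      using u'(1) by blast
  qed
  \<comment> \<open>The total decrease after \<open>n\<close> descents is kept on the left as a sum,
    so that nothing is subtracted in \<open>ennreal\<close>.\<close>
  have chain: "\<exists>u\<in>X. \<phi> u + \<eta> u x + of_nat n * ennreal \<epsilon> \<le> \<phi> x + \<eta> x x" for n
  proof (induction n)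
    case 0
    \<comment> \<open>The witness is \<open>x\<close> itself, with equality; this is why
      \<open>\<eta> x x\<close> appears in the bound.\<close>
    then show ?case
      using \<open>x \<in> X\<close> by auto
  next
    case (Suc n)
    then obtain u where u: "u \<in> X" "\<phi> u + \<eta> u x + of_nat n * ennreal \<epsilon> \<le> \<phi> x + \<eta> x x"
      by blast
    \<comment> \<open>Dropping the accumulated decrease shows that \<open>u\<close> still meets the
      bound required by \<open>descent\<close>.\<close>
    have "\<phi> u + \<eta> u x \<le> \<phi> u + \<eta> u x + of_nat n * ennreal \<epsilon>"
      by simp
    then have "\<phi> u + \<eta> u x \<le> \<phi> x + \<eta> x x"
      using u(2) by (rule order_trans)
    then obtain u' where u': "u' \<in> X" "\<phi> u' + \<eta> u' x + ennreal \<epsilon> \<le> \<phi> u + \<eta> u x"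
      using descent u(1) by blast
    have "\<phi> u' + \<eta> u' x + of_nat (Suc n) * ennreal \<epsilon>
        = (\<phi> u' + \<eta> u' x + ennreal \<epsilon>) + of_nat n * ennreal \<epsilon>"
      by (simp add: algebra_simps)
    also have "\<dots> \<le> \<phi> u + \<eta> u x + of_nat n * ennreal \<epsilon>"
      using u'(2) by (rule add_right_mono)
    finally show ?case
      using u u'(1) by (meson order_trans)
  qed
  \<comment> \<open>Finiteness of the starting value is what lets the Archimedean property bound the
    number of descents.\<close>
  obtain r where r: "0 \<le> r" "\<phi> x + \<eta> x x = ennreal r"
    using assms(5,7) by (cases "\<phi> x + \<eta> x x") auto
  obtain n where n: "r < real n * \<epsilon>"
    using reals_Archimedean3[OF \<open>\<epsilon> > 0\<close>] by blast
  obtain u where "\<phi> u + \<eta> u x + of_nat n * ennreal \<epsilon> \<le> \<phi> x + \<eta> x x"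
    using chain by blast
  then have "of_nat n * ennreal \<epsilon> \<le> ennreal r"
    using r(2) by (metis add_increasing order_trans order_refl zero_le)
  then have "ennreal (real n * \<epsilon>) \<le> ennreal r"
    using \<open>\<epsilon> > 0\<close> by (simp add: ennreal_mult ennreal_of_nat_eq_real_of_nat)
  then show False
    using n r(1) by simp
qed

end
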